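(* Let $L \in \mathbb{R}_{>0}$, $N \in \mathbb{R}_{\ge 0}$ and $\alpha \in (1,4]$. Consider the super-twisting differentiator \begin{align*} \dot y_1 &= \lambda_1 \sqrt{L}\, \lfloor u - y_1 \rceil^{1/2} + y_2, & y_1(0) &= u(0),\\ \dot y_2 &= \lambda_2 L\, \lfloor u - y_1 \rceil^{0}, & y_2(0) &= 0,\\ y &= y_2, \end{align*} with parameters $\lambda_1,\lambda_2>0$ satisfying $$1 < \frac{\lambda_1}{\sqrt{8(\lambda_2+1)}} < \frac{(\alpha+1)\lambda_2 + \alpha - 1}{2\sqrt{\alpha}\,(\lambda_2+1)}.$$ Then, for each input $u = f + \eta$ with $f \in \mathcal{F}_L$ and $\eta \in \mathcal{E}_N$, there exists a finite time $\tau$ depending only on the initial values $\dot f(0)$ and $\eta(0)$ (and on the fixed parameters) such that (every Filippov solution of the differentiator with this input satisfies) $$|y(t) - \dot f(t)| \le 2\sqrt{\alpha(\lambda_2+1)}\,\sqrt{NL} \quad \text{for all } t \ge \tau.$$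
   Context: For $z,p \in \mathbb{R}$, $\lfloor z \rceil^{p} = |z|^p \operatorname{sign}(z)$; in particular $\lfloor z \rceil^0 = \operatorname{sign}(z)$. Solutions of the differentiator (which has a discontinuous right-hand side) are understood in the sense of Filippov. $\mathcal{F}_L$ is the set of differentiable functions $f:\mathbb{R}_{\ge 0}\to\mathbb{R}$ with Lipschitz continuous first derivative such that $|\ddot f(t)| \le L$ for almost every $t \ge 0$. $\mathcal{E}_N$ is the set of Lebesgue measurable functions $\eta:\mathbb{R}_{\ge 0}\to\mathbb{R}$ with $|\eta(t)| \le N$ for all $t \ge 0$. *)

theory Defs
  imports "HOL-Analysis.Analysis"
begin

definition spow :: "real \<Rightarrow> real \<Rightarrow> real" where
  "spow z p = (\<bar>z\<bar> powr p) * sgn z"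

definition filippov_set ::
  "(real \<Rightarrow> real \<times> real \<Rightarrow> real \<times> real) \<Rightarrow> real \<Rightarrow> real \<times> real \<Rightarrow> (real \<times> real) set" where
  "filippov_set F t x =
     (\<Inter>\<delta>\<in>{0<..}. \<Inter>S\<in>null_sets lborel. closure (convex hull (F t ` (ball x \<delta> - S))))"

text \<open>Filippov solution on [0,\<infinity>): locally absolutely continuous (integral of a locally
  integrable derivative) whose derivative lies a.e. in the Filippov set.\<close>
definition filippov_solution ::
  "(real \<Rightarrow> real \<times> real \<Rightarrow> real \<times> real) \<Rightarrow> (real \<Rightarrow> real \<times> real) \<Rightarrow> bool" where
  "filippov_solution F y \<longleftrightarrow>
     (\<exists>g. (\<forall>T\<ge>0. g absolutely_integrable_on {0..T}) \<and>
          (\<forall>t\<ge>0. (g has_integral (y t - y 0)) {0..t}) \<and>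
          (AE t in lborel. t \<ge> 0 \<longrightarrow> g t \<in> filippov_set F t (y t)))"

definition std_field ::
  "real \<Rightarrow> real \<Rightarrow> real \<Rightarrow> (real \<Rightarrow> real) \<Rightarrow> real \<Rightarrow> real \<times> real \<Rightarrow> real \<times> real" where
  "std_field l1 l2 L u t y =
     (l1 * sqrt L * spow (u t - fst y) (1/2) + snd y, l2 * L * spow (u t - fst y) 0)"

definition in_FL :: "real \<Rightarrow> (real \<Rightarrow> real) \<Rightarrow> (real \<Rightarrow> real) \<Rightarrow> bool" where
  "in_FL L f f' \<longleftrightarrow>
     (\<forall>t\<ge>0. (f has_real_derivative f' t) (at t within {0..})) \<and>
     (\<exists>K. K-lipschitz_on {0..} f') \<and>
     (AE t in lborel. t > 0 \<longrightarrow> f' differentiable (at t) \<and> \<bar>deriv f' t\<bar> \<le> L)"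

definition in_EN :: "real \<Rightarrow> (real \<Rightarrow> real) \<Rightarrow> bool" where
  "in_EN N \<eta> \<longleftrightarrow> \<eta> \<in> borel_measurable lebesgue \<and> (\<forall>t\<ge>0. \<bar>\<eta> t\<bar> \<le> N)"

end

theory Submission
  imports Defs
begin

text \<open>
  Put \<open>z\<^sub>1 = y\<^sub>1 - f\<close> and \<open>z\<^sub>2 = y\<^sub>2 - f'\<close>. With \<open>c\<^sup>2 = 2\<alpha>(\<lambda>\<^sub>2 + 1)L\<close>, \<open>b = \<lambda>\<^sub>1\<surd>L / 2\<close> and the
  \<open>C\<^sup>1\<close> function \<open>p\<close> equal to \<open>x\<^sup>2/c\<^sup>2\<close> for \<open>x \<ge> 0\<close> and to \<open>-x\<^sup>2/b\<^sup>2\<close> for \<open>x \<le> 0\<close>, the function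
  \<open>V = max {p(z\<^sub>2) - z\<^sub>1, p(-z\<^sub>2) + z\<^sub>1, z\<^sub>2\<^sup>2/(2c\<^sup>2)}\<close> has upper right derivative at most
  \<open>-\<kappa>\<bar>z\<^sub>2\<bar>\<close> wherever \<open>V > N\<close>: the two bounds on \<open>\<lambda>\<^sub>1\<close> make this true against
  every noise. If moreover \<open>\<bar>z\<^sub>2\<bar> < c\<surd>(V - N)\<close>, then \<open>\<bar>z\<^sub>1\<bar> > N\<close>, so the noise cannot hide the sign
  of \<open>z\<^sub>1\<close> and \<open>z\<^sub>2\<close> moves at a definite rate. Hence \<open>V - N\<close> shrinks by a fixed factor within a
  time proportional to \<open>\<surd>(V - N)\<close>; the geometric series of these times is the settling time
  \<open>\<tau>\<close>, after which \<open>V \<le> N\<close> and so \<open>\<bar>z\<^sub>2\<bar> \<le> c\<surd>(2N)\<close>.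
\<close>

section \<open>Upper right Dini derivatives\<close>

text \<open>The usual limsup of right difference quotients, multiplied out by \<open>s - t\<close>
  so that no limit has to exist and nothing is divided.\<close>

definition dini_le :: "(real \<Rightarrow> real) \<Rightarrow> real \<Rightarrow> real \<Rightarrow> bool" where
  "dini_le h t r \<longleftrightarrow> (\<forall>\<epsilon>>0. \<forall>\<^sub>F s in at_right t. h s - h t \<le> (r + \<epsilon>) * (s - t))"

text \<open>The points of \<open>{a..b}\<close> where the bound with slope
  \<open>r + \<epsilon>\<close> holds form a compact set; the Dini bound at its largest point
  produces a still larger one unless that point is \<open>b\<close>. Then \<open>\<epsilon>\<close>
  tends to zero.\<close>

lemma dini_le_decrease:
  assumes "a \<le> b" and cont: "continuous_on {a..b} h"
    and dini: "\<And>t. a \<le> t \<Longrightarrow> t < b \<Longrightarrow> dini_le h t r"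
  shows "h b - h a \<le> r * (b - a)"
proof -
  have step: "h b - h a \<le> (r + \<epsilon>) * (b - a)" if "\<epsilon> > 0" for \<epsilon>
  proof -
    let ?k = "\<lambda>t. h t - h a - (r + \<epsilon>) * (t - a)"
    define S where "S = {t \<in> {a..b}. ?k t \<le> 0}"
    have "closed S"
      unfolding S_def
      by (intro continuous_on_closed_Collect_le continuous_intros cont closed_atLeastAtMost)
    moreover have "bounded S"
      by (rule bounded_subset[of "{a..b}"]) (auto simp: S_def)
    ultimately have "compact S" by (simp add: compact_eq_bounded_closed)
    moreover have "a \<in> S" using \<open>a \<le> b\<close> by (simp add: S_def)
    ultimately obtain t where t: "t \<in> S" "\<And>s. s \<in> S \<Longrightarrow> s \<le> t"
      using compact_attains_sup[of S] by auto
    have "t = b"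
    proof (rule ccontr)
      assume "t \<noteq> b"
      with t have "a \<le> t" "t < b" by (auto simp: S_def)
      then have "\<forall>\<^sub>F s in at_right t. h s - h t \<le> (r + \<epsilon>) * (s - t)"
        using dini that by (auto simp: dini_le_def)
      moreover have "\<forall>\<^sub>F s in at_right t. s \<in> {t<..<b}"
        using \<open>t < b\<close> by (rule eventually_at_right_real)
      ultimately have "\<forall>\<^sub>F s in at_right t. s \<in> S \<and> t < s"
      proof eventually_elim
        case (elim s)
        then show ?case
          using t(1) by (auto simp: S_def algebra_simps)
      qed
      then obtain s where "s \<in> S" "t < s"
        using eventually_happens'[OF trivial_limit_at_right_real] by blast
      with t(2) show False by fastforce
    qed
    with t(1) show ?thesis by (simp add: S_def)
  qed
  show ?thesis
  proof (rule field_le_epsilon)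
    fix e :: real assume "e > 0"
    \<comment> \<open>The \<open>+ 1\<close> keeps the denominator positive when
      \<open>a = b\<close>.\<close>
    have *: "0 < e / (b - a + 1)" using \<open>a \<le> b\<close> \<open>e > 0\<close> by simp
    have "h b - h a \<le> r * (b - a) + e / (b - a + 1) * (b - a)"
      using step[OF *] by (simp add: algebra_simps)
    also have "e / (b - a + 1) * (b - a) \<le> e"
      using \<open>a \<le> b\<close> \<open>e > 0\<close> by (simp add: field_simps)
    finally show "h b - h a \<le> r * (b - a) + e" by simp
  qed
qed

lemma dini_le_mono: "dini_le h t r \<Longrightarrow> r \<le> r' \<Longrightarrow> dini_le h t r'"
  unfolding dini_le_def
proof (intro allI impI)
  fix \<epsilon> :: real
  assume "\<forall>\<epsilon>>0. \<forall>\<^sub>F s in at_right t. h s - h t \<le> (r + \<epsilon>) * (s - t)" "r \<le> r'" "0 < \<epsilon>"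
  then have "\<forall>\<^sub>F s in at_right t. h s - h t \<le> (r + \<epsilon>) * (s - t)" by simp
  with eventually_at_right_less show "\<forall>\<^sub>F s in at_right t. h s - h t \<le> (r' + \<epsilon>) * (s - t)"
  proof eventually_elim
    case (elim s)
    have "(r + \<epsilon>) * (s - t) \<le> (r' + \<epsilon>) * (s - t)"
      using elim \<open>r \<le> r'\<close> by (intro mult_right_mono) auto
    with elim show ?case by (blast intro: order.trans)
  qed
qed

text \<open>Only a branch that attains the maximum at \<open>t\<close> needs a derivative bound: the
  other one starts strictly below and, by right continuity, stays below the required line just after
  \<open>t\<close>.\<close>

lemma dini_le_max:
  assumes f: "f t \<ge> g t \<Longrightarrow> dini_le f t r" and g: "g t \<ge> f t \<Longrightarrow> dini_le g t r"
    and cf: "(f \<longlongrightarrow> f t) (at_right t)" and cg: "(g \<longlongrightarrow> g t) (at_right t)"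
  shows "dini_le (\<lambda>t. max (f t) (g t)) t r"
proof -
  have inactive: "\<forall>\<^sub>F s in at_right t. p s - q t \<le> (r + \<epsilon>) * (s - t)"
    if "p t < q t" "(p \<longlongrightarrow> p t) (at_right t)" for p q :: "real \<Rightarrow> real" and \<epsilon>
  proof -
    have "((\<lambda>s. p s - q t - (r + \<epsilon>) * (s - t)) \<longlongrightarrow> p t - q t - (r + \<epsilon>) * (t - t)) (at_right t)"
      by (intro tendsto_intros that)
    then have "\<forall>\<^sub>F s in at_right t. p s - q t - (r + \<epsilon>) * (s - t) < 0"
      by (rule order_tendstoD(2)) (use that in simp)
    then show ?thesis by (rule eventually_mono) simp
  qed
  show ?thesis
    unfolding dini_le_def
  proof (intro allI impI)
    fix \<epsilon> :: real assume "\<epsilon> > 0"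
    have "\<forall>\<^sub>F s in at_right t. f s - max (f t) (g t) \<le> (r + \<epsilon>) * (s - t)"
    proof (cases "f t \<ge> g t")
      case True
      with f \<open>\<epsilon> > 0\<close> show ?thesis by (auto simp: dini_le_def max_def)
    next
      case False
      then show ?thesis using inactive[of f g \<epsilon>] cf by (simp add: max_def)
    qed
    moreover have "\<forall>\<^sub>F s in at_right t. g s - max (f t) (g t) \<le> (r + \<epsilon>) * (s - t)"
    proof (cases "g t \<ge> f t")
      case True
      with g \<open>\<epsilon> > 0\<close> show ?thesis by (auto simp: dini_le_def max.absorb2)
    next
      case False
      then show ?thesis using inactive[of g f \<epsilon>] cg by (simp add: max_def)
    qed
    ultimately show "\<forall>\<^sub>F s in at_right t.
        max (f s) (g s) - max (f t) (g t) \<le> (r + \<epsilon>) * (s - t)"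
      by eventually_elim (auto simp: le_max_iff_disj max_diff_distrib_left)
  qed
qed

lemma dini_le_const: "dini_le (\<lambda>_. x) t 0"
  by (auto simp: dini_le_def intro: eventually_mono[OF eventually_at_right_less])

lemma tendsto_at_right_of_continuous_on_Ici:
  fixes h :: "real \<Rightarrow> real"
  assumes "continuous_on {a..} h" "a \<le> t"
  shows "(h \<longlongrightarrow> h t) (at_right t)"
proof -
  have "(h \<longlongrightarrow> h t) (at t within {a..})"
    using assms by (auto simp: continuous_on_def)
  then show ?thesis
    by (rule tendsto_within_subset) (use assms in auto)
qed

text \<open>Truncating \<open>h\<close> from below at a level \<open>m\<close> leaves a function
  that never increases, since the bound on \<open>h\<close> is called on only where
  \<open>h t \<ge> m\<close>. The level lies strictly above \<open>M\<close> because nothing is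
  assumed where \<open>h t = M\<close>.\<close>

lemma dini_le_threshold:
  assumes "a \<le> b" and cont: "continuous_on {a..} h"
    and dini: "\<And>t. a \<le> t \<Longrightarrow> h t > M \<Longrightarrow> dini_le h t 0"
  shows "h b \<le> max (h a) M"
proof -
  have step: "h b \<le> max (h a) m" if "m > M" for m
  proof -
    let ?k = "\<lambda>t. max (h t) m"
    have "?k b - ?k a \<le> 0 * (b - a)"
    proof (rule dini_le_decrease[OF \<open>a \<le> b\<close>])
      show "continuous_on {a..b} ?k"
        by (intro continuous_on_max continuous_intros continuous_on_subset[OF cont]) auto
      show "dini_le ?k t 0" if "a \<le> t" "t < b" for t
        using dini_le_max[of "\<lambda>_. m" t h 0] dini[of t] \<open>m > M\<close> that
          tendsto_at_right_of_continuous_on_Ici[OF cont \<open>a \<le> t\<close>]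
        by (auto simp: dini_le_const max.commute[of _ m])
    qed
    then show ?thesis by simp
  qed
  show ?thesis
  proof (rule ccontr)
    assume "\<not> ?thesis"
    then show False using step[of "(h b + M) / 2"] by (simp add: max_def split: if_splits)
  qed
qed

section \<open>Increments of Lipschitz functions from almost everywhere derivative bounds\<close>

lemma dini_le_of_deriv:
  assumes "(h has_real_derivative d) (at t)" "d \<le> r"
  shows "dini_le h t r"
  unfolding dini_le_def
proof (intro allI impI)
  fix \<epsilon> :: real assume "\<epsilon> > 0"
  have "((\<lambda>s. (h s - h t) / (s - t)) \<longlongrightarrow> d) (at_right t)"
    using assms(1) by (auto simp: has_field_derivative_iff intro: tendsto_within_subset)
  then have "\<forall>\<^sub>F s in at_right t. (h s - h t) / (s - t) < r + \<epsilon>"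
    by (rule order_tendstoD(2)) (use \<open>\<epsilon> > 0\<close> assms(2) in simp)
  with eventually_at_right_less show "\<forall>\<^sub>F s in at_right t. h s - h t \<le> (r + \<epsilon>) * (s - t)"
    by eventually_elim (simp add: field_simps)
qed

text \<open>A null set of exceptional points is covered by an open set \<open>U\<close> of small measure; subtracting
  a multiple of the measure of \<open>U \<inter> [a, t]\<close> absorbs the growth of \<open>f\<close> at these points.\<close>

lemma diff_le_of_AE_deriv_le:
  fixes f :: "real \<Rightarrow> real"
  assumes ab: "a \<le> b" and lip: "K-lipschitz_on {a..b} f"
    and ae: "AE t in lborel. a < t \<longrightarrow> t < b \<longrightarrow> (\<exists>d\<le>r. (f has_real_derivative d) (at t))"
  shows "f b - f a \<le> r * (b - a)"
proof -
  obtain S where S: "S \<in> null_sets lborel"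
    and deriv: "\<And>t. a < t \<Longrightarrow> t < b \<Longrightarrow> t \<notin> S \<Longrightarrow> \<exists>d\<le>r. (f has_real_derivative d) (at t)"
  proof -
    from ae obtain S where "S \<in> null_sets lborel"
      "{t \<in> space lborel. \<not> (a < t \<longrightarrow> t < b \<longrightarrow> (\<exists>d\<le>r. (f has_real_derivative d) (at t)))} \<subseteq> S"
      by (auto simp: eventually_ae_filter)
    then show thesis by (intro that[of S]) auto
  qed
  \<comment> \<open>The derivative bound is given only inside the open interval, so the left end
    point joins the exceptional set.\<close>
  have S': "insert a S \<in> null_sets lborel" 
    using null_sets.Un[OF _ S, of "{a}"] by (simp add: null_sets_def)
  \<comment> \<open>Near an exceptional point \<open>K\<close> cancels the growth of
    \<open>f\<close>, and \<open>\<bar>r\<bar>\<close> lowers the slope further to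
    \<open>- \<bar>r\<bar> \<le> r\<close>.\<close>
  let ?K = "K + \<bar>r\<bar>"
  have "K \<ge> 0" using lip by (rule lipschitz_on_nonneg)
  then have "?K \<ge> 0" by simp
  have step: "f b - f a \<le> r * (b - a) + ?K * e" if "e > 0" for e
  proof -
    obtain U where U: "open U" "insert a S \<subseteq> U" "emeasure lborel (U - insert a S) < ennreal e"
      using outer_regular_lborel[of "insert a S" e] S' \<open>e > 0\<close> by (auto simp: null_sets_def)
    have Ub: "U \<in> sets lborel" using U(1) by simp
    have eU: "emeasure lborel U < ennreal e"
      using U(3) emeasure_Diff_null_set[OF S' Ub] by simp
    define m where "m t = measure lborel (U \<inter> {a..t})" for t
    have icc: "{c..d} \<in> fmeasurable lborel" for c d :: real
      using fmeasurable_cbox[of c d] by simp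
    have fin: "U \<inter> {c..d} \<in> fmeasurable lborel" for c d
      by (rule fmeasurableI2[OF icc[of c d]]) (use Ub in auto)
    have sing: "measure lborel (U \<inter> {t..t}) = 0" for t
      by (cases "t \<in> U") (simp_all add: Int_insert_right)
    have m_add: "m s = m t + measure lborel (U \<inter> {t..s})" if "a \<le> t" "t \<le> s" for s t
    proof -
      have eq: "U \<inter> {a..s} = (U \<inter> {a..t}) \<union> (U \<inter> {t..s})"
        "(U \<inter> {a..t}) \<inter> (U \<inter> {t..s}) = U \<inter> {t..t}"
        using that by auto
      show ?thesis
        unfolding m_def eq(1) measure_Un3[OF fin fin] eq(2) sing by (rule diff_zero)
    qed
    have m_lip: "\<bar>m s - m t\<bar> \<le> \<bar>s - t\<bar>" if "a \<le> t" "a \<le> s" for s t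
    proof -
      have "\<bar>m s - m t\<bar> \<le> s - t" if "a \<le> t" "t \<le> s" for s t
      proof -
        have "measure lborel (U \<inter> {t..s}) \<le> measure lborel {t..s}"
          by (rule measure_mono_fmeasurable[OF _ fmeasurableD[OF fin] icc]) auto
        then show ?thesis using m_add[OF that] that by simp
      qed
      from this[of t s] this[of s t] that show ?thesis by linarith
    qed
    have m_full: "m s - m t = s - t" if "a \<le> t" "t \<le> s" "{t..s} \<subseteq> U" for s t
    proof -
      have "U \<inter> {t..s} = {t..s}" using that by auto
      then show ?thesis using m_add[OF that(1,2)] that by simp
    qed
    have cont: "continuous_on {a..b} m"
      by (rule lipschitz_on_continuous_on[of 1])
         (use m_lip in \<open>auto simp: lipschitz_on_def dist_real_def\<close>)
    have dini: "dini_le (\<lambda>t. f t - ?K * m t) t r" if t: "a \<le> t" "t < b" for t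
    proof (cases "t \<in> insert a S")
      case False
      then obtain d where d: "d \<le> r" "(f has_real_derivative d) (at t)"
        using deriv t by force
      show ?thesis
        unfolding dini_le_def
      proof (intro allI impI)
        fix \<epsilon> :: real assume "\<epsilon> > 0"
        then have "\<forall>\<^sub>F s in at_right t. f s - f t \<le> (r + \<epsilon>) * (s - t)"
          using dini_le_of_deriv[OF d(2,1)] by (simp add: dini_le_def)
        with eventually_at_right_less
        show "\<forall>\<^sub>F s in at_right t. f s - ?K * m s - (f t - ?K * m t) \<le> (r + \<epsilon>) * (s - t)"
        proof eventually_elim
          case (elim s)
          have "?K * m t \<le> ?K * m s"
            using m_add[of t s] elim t \<open>?K \<ge> 0\<close> by (intro mult_left_mono) auto
          with elim show ?case by simp
        qed
      qed
    next
      case True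
      \<comment> \<open>A whole neighbourhood of \<open>t\<close> lies in \<open>U\<close>, and
        there \<open>m\<close> grows at unit speed.\<close>
      then obtain \<delta> where \<delta>: "\<delta> > 0" "ball t \<delta> \<subseteq> U"
        using U by (meson openE subset_iff)
      show ?thesis
        unfolding dini_le_def
      proof (intro allI impI)
        fix \<epsilon> :: real assume "\<epsilon> > 0"
        have "\<forall>\<^sub>F s in at_right t. s \<in> {t<..<min b (t + \<delta>)}"
          using \<delta> t by (intro eventually_at_right_real) auto
        then show "\<forall>\<^sub>F s in at_right t. f s - ?K * m s - (f t - ?K * m t) \<le> (r + \<epsilon>) * (s - t)"
        proof eventually_elim
          case (elim s)
          have "{t..s} \<subseteq> U" using \<delta>(2) elim by (auto simp: dist_real_def subset_iff)
          then have "m s - m t = s - t" using m_full t elim by auto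
          then have "?K * m s - ?K * m t = ?K * (s - t)" by (simp add: right_diff_distrib[symmetric])
          moreover have "\<bar>f s - f t\<bar> \<le> K * \<bar>s - t\<bar>"
            using lipschitz_onD[OF lip, of s t] t elim by (auto simp: dist_real_def)
          ultimately have "f s - ?K * m s - (f t - ?K * m t) \<le> - \<bar>r\<bar> * (s - t)"
            using elim by (auto simp: algebra_simps)
          also have "\<dots> \<le> (r + \<epsilon>) * (s - t)"
            using elim \<open>\<epsilon> > 0\<close> by (intro mult_right_mono) auto
          finally show ?case .
        qed
      qed
    qed
    have "f b - ?K * m b - (f a - ?K * m a) \<le> r * (b - a)"
      by (rule dini_le_decrease[OF ab _ dini])
         (auto intro!: continuous_intros cont lipschitz_on_continuous_on[OF lip])
    moreover have "m a = 0"
      by (simp only: m_def sing)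
    moreover have "m b \<le> e"
    proof -
      have "emeasure lborel (U \<inter> {a..b}) \<le> ennreal e"
        using emeasure_mono[of "U \<inter> {a..b}" U lborel] Ub eU by auto
      then show ?thesis
        using \<open>e > 0\<close> by (simp add: m_def measure_def enn2real_leI)
    qed
    then have "?K * m b \<le> ?K * e" using \<open>?K \<ge> 0\<close> by (rule mult_left_mono)
    ultimately show ?thesis by simp
  qed
  show ?thesis
  proof (rule field_le_epsilon)
    fix e :: real assume "e > 0"
    then have *: "0 < e / (?K + 1)" using \<open>?K \<ge> 0\<close> by (intro divide_pos_pos) auto
    have "f b - f a \<le> r * (b - a) + ?K * (e / (?K + 1))"
      using step[OF *] by simp
    also have "?K * (e / (?K + 1)) \<le> e"
      using \<open>?K \<ge> 0\<close> \<open>e > 0\<close> by (simp add: field_simps)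
    finally show "f b - f a \<le> r * (b - a) + e" by simp
  qed
qed

lemma has_integral_le_const_negligible:
  fixes g :: "real \<Rightarrow> real"
  assumes "(g has_integral I) {a..b}" "a \<le> b" "negligible S"
    and "\<And>r. r \<in> {a..b} - S \<Longrightarrow> g r \<le> C"
  shows "I \<le> C * (b - a)"
proof -
  have "((\<lambda>r. if r \<in> S then C else g r) has_integral I) {a..b}"
    by (rule has_integral_spike[OF assms(3) _ assms(1)]) auto
  moreover have "((\<lambda>r. C) has_integral C * (b - a)) {a..b}"
    using has_integral_const_real[of C a b] \<open>a \<le> b\<close> by (simp add: mult.commute)
  ultimately show ?thesis
    by (rule has_integral_le) (use assms(4) in auto)
qed

section \<open>Filippov set of the differentiator\<close>

text \<open>One radius and the empty null set already bound the intersection from above.\<close>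

lemma filippov_set_subset:
  assumes "\<delta> > 0" "F t ` ball x \<delta> \<subseteq> K" "closed K" "convex K"
  shows "filippov_set F t x \<subseteq> K"
proof -
  have "filippov_set F t x \<subseteq> closure (convex hull (F t ` (ball x \<delta> - {})))"
    unfolding filippov_set_def using \<open>\<delta> > 0\<close> by blast
  also have "\<dots> \<subseteq> K"
    using assms by (intro closure_minimal hull_minimal) auto
  finally show ?thesis .
qed

lemma spow_half: "spow z (1/2) = sqrt z"
  by (cases "z = 0"; cases "z > 0")
     (auto simp: spow_def powr_half_sqrt real_sqrt_minus[symmetric] simp del: real_sqrt_minus)

lemma spow_zero: "spow z 0 = sgn z"
  by (auto simp: spow_def)

text \<open>The first component is continuous in the state, so shrinking balls leave only its value.
  The second has constant sign off the switching line; on that line only the bound survives.\<close>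

lemma std_field_filippov:
  assumes g: "g \<in> filippov_set (std_field l1 l2 L u) t x" and nonneg: "l2 \<ge> 0" "L \<ge> 0"
  shows "fst g = l1 * sqrt L * sqrt (u t - fst x) + snd x"
    and "\<bar>snd g\<bar> \<le> l2 * L"
    and "u t > fst x \<Longrightarrow> snd g = l2 * L"
    and "u t < fst x \<Longrightarrow> snd g = - (l2 * L)"
proof -
  let ?G = "\<lambda>x. l1 * sqrt L * sqrt (u t - fst x) + snd x"
  have field: "std_field l1 l2 L u t x = (?G x, l2 * L * sgn (u t - fst x))" for x
    by (simp add: std_field_def spow_half spow_zero)
  show "fst g = ?G x"
  proof -
    have "dist (fst g) (?G x) \<le> e" if "e > 0" for e
    proof -
      have "isCont ?G x" by (intro continuous_intros)
      then obtain \<delta> where "\<delta> > 0" "\<And>x'. dist x' x < \<delta> \<Longrightarrow> dist (?G x') (?G x) < e"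
        using \<open>e > 0\<close> unfolding continuous_at_eps_delta by metis
      then have "std_field l1 l2 L u t ` ball x \<delta> \<subseteq> cball (?G x) e \<times> UNIV"
        by (auto simp: field dist_commute less_imp_le)
      from filippov_set_subset[where F="std_field l1 l2 L u", OF \<open>\<delta> > 0\<close> this] g show ?thesis
        by (auto simp: closed_Times convex_Times dist_commute mem_Times_iff)
    qed
    then have "dist (fst g) (?G x) \<le> 0" by (rule field_le_epsilon[of _ 0, simplified])
    then show ?thesis by simp
  qed
  have prod: "l2 * L \<ge> 0" using nonneg by simp
  have "std_field l1 l2 L u t ` ball x 1 \<subseteq> UNIV \<times> cball 0 (l2 * L)"
    using prod by (auto simp: field sgn_if)
  from filippov_set_subset[where F="std_field l1 l2 L u", OF _ this] g show "\<bar>snd g\<bar> \<le> l2 * L"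
    by (auto simp: closed_Times convex_Times mem_Times_iff)
  have near: "\<bar>fst x' - fst x\<bar> < d" if "dist x x' < d" for x' d
    using dist_fst_le[of x' x] that by (simp add: dist_real_def dist_commute)
  show "snd g = l2 * L" if "u t > fst x"
  proof -
    \<comment> \<open>The radius is the distance from \<open>x\<close> to the switching line, so the
      sign is constant on the ball.\<close>
    have "std_field l1 l2 L u t ` ball x (u t - fst x) \<subseteq> UNIV \<times> {l2 * L}"
      using near[of _ "u t - fst x"] by (fastforce simp: field sgn_if)
    from filippov_set_subset[where F="std_field l1 l2 L u", OF _ this] g that show ?thesis
      by (auto simp: closed_Times convex_Times mem_Times_iff)
  qed
  show "snd g = - (l2 * L)" if "u t < fst x"
  proof -
    have "std_field l1 l2 L u t ` ball x (fst x - u t) \<subseteq> UNIV \<times> {- (l2 * L)}"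
      using near[of _ "fst x - u t"] by (fastforce simp: field sgn_if)
    from filippov_set_subset[where F="std_field l1 l2 L u", OF _ this] g that show ?thesis
      by (auto simp: closed_Times convex_Times mem_Times_iff)
  qed
qed

section \<open>The Lyapunov function\<close>

text \<open>Here \<open>c_large\<close> and \<open>c_return\<close> say that the curve \<open>x\<^sub>2 = c\<surd>(x\<^sub>1 + N)\<close> is crossed inwards, for
  the noise that drives \<open>x\<^sub>2\<close> up and for the noise that pushes \<open>x\<^sub>1\<close> back, respectively;
  \<open>b_gain\<close> does so for \<open>x\<^sub>2 = -b\<surd>(-N - x\<^sub>1)\<close> in the part left of \<open>-N\<close>.\<close>

locale st_gains =
  fixes k1 k2 L b c :: real
  assumes L_nonneg: "L \<ge> 0" and L_less: "L < k2" and b_pos: "b > 0" and c_pos: "c > 0"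
    and c_large: "2 * (k2 + L) < c\<^sup>2"
    and c_return: "c * (k1 - c) < 2 * (k2 - L)"
    and b_gain: "2 * (k2 + L) < b * (k1 - b)"
begin

text \<open>The level curve \<open>p x2 - x1 = N\<close> joins the arcs
  \<open>x2 = c * sqrt (x1 + N)\<close> and \<open>x2 = - b * sqrt (- N - x1)\<close> smoothly at
  \<open>(- N, 0)\<close>.\<close>

definition p :: "real \<Rightarrow> real" where
  "p x = (max x 0)\<^sup>2 / c\<^sup>2 - (max (- x) 0)\<^sup>2 / b\<^sup>2"

definition dp :: "real \<Rightarrow> real" where
  "dp x = 2 * max x 0 / c\<^sup>2 + 2 * max (- x) 0 / b\<^sup>2"

text \<open>The entries are the decay margins of four situations: upper arc with noise at or above
  \<open>x1\<close>, upper arc with noise below \<open>x1\<close>, lower arc, and the term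
  \<open>x2^2 / (2 * c^2)\<close> of \<open>V\<close>. They are positive by \<open>c_large\<close>,
  \<open>c_return\<close>, \<open>b_gain\<close> and \<open>L_less\<close>, in this order.\<close>

definition \<kappa> :: real where
  "\<kappa> = Min {1 - 2 * (k2 + L) / c\<^sup>2, 1 + 2 * (k2 - L) / c\<^sup>2 - k1 / c,
            k1 / b - 1 - 2 * (k2 + L) / b\<^sup>2, (k2 - L) / c\<^sup>2}"

lemma k2_pos: "k2 > 0" using L_nonneg L_less by simp

lemma k1_pos: "k1 > 0"
proof -
  have "0 < b * (k1 - b)" using b_gain k2_pos L_nonneg by simp
  then show ?thesis using b_pos by (simp add: zero_less_mult_iff)
qed

lemma \<kappa>_pos: "\<kappa> > 0"
proof -
  have "1 + 2 * (k2 - L) / c\<^sup>2 - k1 / c = (2 * (k2 - L) - c * (k1 - c)) / c\<^sup>2"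
    "k1 / b - 1 - 2 * (k2 + L) / b\<^sup>2 = (b * (k1 - b) - 2 * (k2 + L)) / b\<^sup>2"
    using b_pos c_pos by (simp_all add: field_simps power2_eq_square)
  then show ?thesis
    using c_large c_return b_gain L_less b_pos c_pos by (simp add: \<kappa>_def)
qed

lemma \<kappa>_le:
  "\<kappa> \<le> 1 - 2 * (k2 + L) / c\<^sup>2" "\<kappa> \<le> 1 + 2 * (k2 - L) / c\<^sup>2 - k1 / c"
  "\<kappa> \<le> k1 / b - 1 - 2 * (k2 + L) / b\<^sup>2" "\<kappa> \<le> (k2 - L) / c\<^sup>2"
  by (simp_all add: \<kappa>_def)

lemma p_le: "p x \<le> x\<^sup>2 / c\<^sup>2"
proof (cases "x \<ge> 0")
  case False
  then have "p x = - (x\<^sup>2 / b\<^sup>2)" by (simp add: p_def)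
  also have "\<dots> \<le> 0" by simp
  also have "0 \<le> x\<^sup>2 / c\<^sup>2" by simp
  finally show ?thesis .
qed (simp add: p_def)

lemma continuous_on_p [continuous_intros]: "continuous_on A f \<Longrightarrow> continuous_on A (\<lambda>x. p (f x))"
  unfolding p_def using b_pos c_pos by (intro continuous_intros) auto

lemma continuous_on_dp [continuous_intros]: "continuous_on A f \<Longrightarrow> continuous_on A (\<lambda>x. dp (f x))"
  unfolding dp_def using b_pos c_pos by (intro continuous_intros) auto

lemma dp_nonneg: "dp x \<ge> 0"
  by (simp add: dp_def)

lemma p_has_derivative: "(p has_real_derivative dp x) (at x)"
proof -
  have sq: "((\<lambda>x. x\<^sup>2 / a\<^sup>2) has_real_derivative 2 * x / a\<^sup>2) (at x)" for a :: real
    by (rule DERIV_cdivide) (auto intro!: derivative_eq_intros)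
  consider "x > 0" | "x < 0" | "x = 0" by linarith
  then show ?thesis
  proof cases
    case 1
    with sq[of c] have "((\<lambda>x. x\<^sup>2 / c\<^sup>2) has_real_derivative dp x) (at x)"
      by (simp add: dp_def)
    then show ?thesis
      by (rule has_field_derivative_transform_within_open[of _ _ _ "{0<..}"])
         (use 1 in \<open>auto simp: p_def\<close>)
  next
    case 2
    with DERIV_minus[OF sq[of b]] have "((\<lambda>x. - (x\<^sup>2 / b\<^sup>2)) has_real_derivative dp x) (at x)"
      by (simp add: dp_def)
    then show ?thesis
      by (rule has_field_derivative_transform_within_open[of _ _ _ "{..<0}"])
         (use 2 in \<open>auto simp: p_def\<close>)
  next
    case 3
    have "isCont dp 0"
      using continuous_on_dp[OF continuous_on_id, of UNIV] by (simp add: continuous_on_eq_continuous_at)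
    then have "((\<lambda>y. dp y / 2) \<longlongrightarrow> dp 0 / 2) (at 0)"
      by (intro tendsto_intros) (auto simp: isCont_def)
    \<comment> \<open>For a signed square the difference quotient at the origin is half the
      derivative; at \<open>y = 0\<close> both sides are \<open>0\<close> because division by zero
      gives \<open>0\<close>.\<close>
    moreover have "dp y / 2 = (p y - p 0) / (y - 0)" for y
      by (auto simp: dp_def p_def max_def power2_eq_square)
    ultimately have "((\<lambda>y. (p y - p 0) / (y - 0)) \<longlongrightarrow> dp 0 / 2) (at 0)"
      by (simp only:)
    moreover have "dp 0 = 0" by (simp add: dp_def)
    ultimately show ?thesis
      using 3 by (simp only: has_field_derivative_iff) simp
  qed
qed

text \<open>The left-hand side is the derivative of \<open>p x2 - x1\<close> under noise
  \<open>e\<close> and switching term \<open>v\<close>, with the worst value \<open>- L\<close> of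
  the second derivative of the signal.\<close>

lemma rate:
  assumes "\<bar>e\<bar> \<le> N" and U: "p x2 - x1 \<ge> N" and v: "\<bar>v\<bar> \<le> k2" "e < x1 \<Longrightarrow> v = - k2"
  shows "- (k1 * sqrt (e - x1) + x2) + dp x2 * (v + L) \<le> - \<kappa> * \<bar>x2\<bar>"
proof (cases "x2 \<ge> 0")
  case x2: True
  then have p: "p x2 = (x2 / c)\<^sup>2" "dp x2 = 2 * x2 / c\<^sup>2" by (simp_all add: p_def dp_def power_divide)
  show ?thesis
  proof (cases "e < x1")
    case True
    \<comment> \<open>\<open>U\<close> and \<open>e \<ge> - N\<close> give
      \<open>x1 - e \<le> p x2\<close>, which limits the backward push on \<open>x1\<close>.\<close>
    have "sqrt (x1 - e) \<le> x2 / c"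
      using assms(1) U p x2 c_pos by (intro real_le_lsqrt) auto
    then have "k1 * sqrt (x1 - e) \<le> k1 * (x2 / c)"
      using k1_pos by (intro mult_left_mono) auto
    moreover have "sqrt (e - x1) = - sqrt (x1 - e)"
      using real_sqrt_minus[of "x1 - e"] by simp
    moreover have "dp x2 * (v + L) = - (2 * (k2 - L) / c\<^sup>2 * x2)"
      using v(2)[OF True] by (simp add: p(2) minus_divide_left algebra_simps)
    moreover have "\<kappa> * x2 \<le> (1 + 2 * (k2 - L) / c\<^sup>2 - k1 / c) * x2"
      using \<kappa>_le(2) x2 by (rule mult_right_mono)
    ultimately show ?thesis using x2 by (simp add: algebra_simps)
  next
    case False
    then have "k1 * sqrt (e - x1) \<ge> 0" using k1_pos by simp
    moreover have "dp x2 * (v + L) \<le> dp x2 * (k2 + L)"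
      using v dp_nonneg by (intro mult_left_mono) auto
    moreover have "\<kappa> * x2 \<le> (1 - 2 * (k2 + L) / c\<^sup>2) * x2"
      using \<kappa>_le(1) x2 by (rule mult_right_mono)
    moreover have "dp x2 * (k2 + L) = 2 * (k2 + L) / c\<^sup>2 * x2" by (simp add: p(2))
    ultimately show ?thesis using x2 by (simp add: algebra_simps)
  qed
next
  case False
  then have p: "p x2 = - (- x2 / b)\<^sup>2" "dp x2 = 2 * (- x2) / b\<^sup>2"
    by (simp_all add: p_def dp_def power_divide)
  \<comment> \<open>Here \<open>U\<close> places \<open>x1\<close> so far to the left of the noise
    that the correction outweighs the negative \<open>x2\<close>.\<close>
  have "- x2 / b \<le> sqrt (e - x1)"
    using assms(1) U p by (intro real_le_rsqrt) auto
  then have "k1 * (- x2 / b) \<le> k1 * sqrt (e - x1)"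
    using k1_pos by (intro mult_left_mono) auto
  moreover have "dp x2 * (v + L) \<le> dp x2 * (k2 + L)"
    using v dp_nonneg by (intro mult_left_mono) auto
  moreover have "\<kappa> * (- x2) \<le> (k1 / b - 1 - 2 * (k2 + L) / b\<^sup>2) * (- x2)"
    using \<kappa>_le(3) False by (intro mult_right_mono) auto
  moreover have "dp x2 * (k2 + L) = 2 * (k2 + L) / b\<^sup>2 * (- x2)" by (simp add: p(2))
  ultimately show ?thesis using False by (simp add: algebra_simps)
qed

end

text \<open>Differences of solutions, with noise \<open>\<eta>\<close> and \<open>D = f'\<close>. The square root of the library is odd,
  so it is the signed square root. All assumptions survive a change of sign
  of the trajectory, which exchanges the two sides of \<open>V\<close>.\<close>

locale st_error = st_gains +
  fixes N :: real and z1 z2 D \<eta> g1 g2 :: "real \<Rightarrow> real" and S :: "real set"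
  assumes g1_integral: "\<And>s t. 0 \<le> t \<Longrightarrow> t \<le> s \<Longrightarrow> (g1 has_integral (z1 s - z1 t)) {t..s}"
    and g2_integral: "\<And>s t. 0 \<le> t \<Longrightarrow> t \<le> s \<Longrightarrow>
      (g2 has_integral (z2 s + D s - (z2 t + D t))) {t..s}"
    and D_lipschitz: "\<And>s t. 0 \<le> t \<Longrightarrow> t \<le> s \<Longrightarrow> \<bar>D s - D t\<bar> \<le> L * (s - t)"
    and negl: "negligible S"
    and noise: "\<And>t. 0 \<le> t \<Longrightarrow> \<bar>\<eta> t\<bar> \<le> N"
    and g1_eq: "\<And>t. 0 \<le> t \<Longrightarrow> t \<notin> S \<Longrightarrow> g1 t = k1 * sqrt (\<eta> t - z1 t) + z2 t"
    and g2_bound: "\<And>t. 0 \<le> t \<Longrightarrow> t \<notin> S \<Longrightarrow> \<bar>g2 t\<bar> \<le> k2"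
    and g2_pos: "\<And>t. 0 \<le> t \<Longrightarrow> t \<notin> S \<Longrightarrow> z1 t < \<eta> t \<Longrightarrow> g2 t = k2"
    and g2_neg: "\<And>t. 0 \<le> t \<Longrightarrow> t \<notin> S \<Longrightarrow> \<eta> t < z1 t \<Longrightarrow> g2 t = - k2"
begin

section \<open>Increments and continuity of the error trajectories\<close>

lemma N_nonneg: "N \<ge> 0"
  using noise[of 0] by simp

lemma st_error_uminus:
  "st_error k1 k2 L b c N (\<lambda>t. - z1 t) (\<lambda>t. - z2 t) (\<lambda>t. - D t) (\<lambda>t. - \<eta> t)
     (\<lambda>t. - g1 t) (\<lambda>t. - g2 t) S"
proof
  fix s t :: real assume st: "0 \<le> t" "t \<le> s"
  show "((\<lambda>t. - g1 t) has_integral - z1 s - - z1 t) {t..s}"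
    using has_integral_neg[OF g1_integral[OF st]] by simp
  show "((\<lambda>t. - g2 t) has_integral - z2 s + - D s - (- z2 t + - D t)) {t..s}"
    using has_integral_neg[OF g2_integral[OF st]] by (simp add: algebra_simps)
  show "\<bar>- D s - - D t\<bar> \<le> L * (s - t)"
    using D_lipschitz[OF st] by linarith
next
  fix t :: real assume t: "0 \<le> t" "t \<notin> S"
  have "sqrt (- \<eta> t - - z1 t) = - sqrt (\<eta> t - z1 t)"
    using real_sqrt_minus[of "\<eta> t - z1 t"] by simp
  then show "- g1 t = k1 * sqrt (- \<eta> t - - z1 t) + - z2 t"
    using g1_eq[OF t] by simp
qed (use noise negl g2_bound g2_pos g2_neg in auto)

lemma z2_diff: "\<bar>z2 s - z2 t\<bar> \<le> (k2 + L) * (s - t)" if st: "0 \<le> t" "t \<le> s"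
proof -
  have "z2 s + D s - (z2 t + D t) \<le> k2 * (s - t)"
    by (rule has_integral_le_const_negligible[OF g2_integral[OF st] st(2) negl])
       (use g2_bound st in \<open>force simp: abs_le_iff\<close>)
  moreover have "- (z2 s + D s - (z2 t + D t)) \<le> k2 * (s - t)"
    by (rule has_integral_le_const_negligible[OF has_integral_neg[OF g2_integral[OF st]] st(2) negl])
       (use g2_bound st in \<open>force simp: abs_le_iff\<close>)
  ultimately show ?thesis
    using D_lipschitz[OF st] by (simp add: abs_le_iff algebra_simps)
qed

text \<open>Above \<open>N\<close> every admissible noise lies below \<open>z1\<close>, so
  \<open>g2 = - k2\<close> off \<open>S\<close>, and \<open>D\<close> can offset at most
  \<open>L\<close> of this rate.\<close>

lemma z2_decrease:
  assumes st: "0 \<le> t" "t \<le> s" and z1: "\<And>r. r \<in> {t..s} \<Longrightarrow> z1 r > N"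
  shows "z2 s - z2 t \<le> - (k2 - L) * (s - t)"
proof -
  have "g2 r \<le> - k2" if "r \<in> {t..s} - S" for r
    using g2_neg[of r] noise[of r] z1[of r] that st by auto
  then have "z2 s + D s - (z2 t + D t) \<le> - k2 * (s - t)"
    by (rule has_integral_le_const_negligible[OF g2_integral[OF st] st(2) negl])
  with D_lipschitz[OF st] show ?thesis by (simp add: abs_le_iff algebra_simps)
qed

lemma continuous_on_z1 [continuous_intros]: "A \<subseteq> {0..} \<Longrightarrow> continuous_on A z1"
proof -
  have on_Icc: "continuous_on {0..T} z1" if "T \<ge> 0" for T
  proof -
    have "g1 integrable_on {0..T}" using g1_integral[of 0 T] that by auto
    then have "continuous_on {0..T} (\<lambda>t. z1 0 + integral {0..t} g1)"
      by (intro continuous_intros indefinite_integral_continuous_1)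
    moreover have "z1 0 + integral {0..t} g1 = z1 t" if "t \<in> {0..T}" for t
      using integral_unique[OF g1_integral[of 0 t]] that by simp
    ultimately show ?thesis by (rule continuous_on_eq)
  qed
  have "continuous_on {0..} z1"
    unfolding continuous_on_eq_continuous_within
  proof
    fix t :: real assume t: "t \<in> {0..}"
    have "continuous (at t within {0..t + 1}) z1"
      using on_Icc[of "t + 1"] t by (auto simp: continuous_on_eq_continuous_within)
    moreover have "at t within {0..} = at t within {0..t + 1}"
      by (rule at_within_nhd[of t "{..<t + 1}"]) auto
    ultimately show "continuous (at t within {0..}) z1" by simp
  qed
  then show "A \<subseteq> {0..} \<Longrightarrow> continuous_on A z1" by (rule continuous_on_subset)
qed

lemma continuous_on_z2 [continuous_intros]: "A \<subseteq> {0..} \<Longrightarrow> continuous_on A z2"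
proof -
  have "\<bar>z2 s - z2 t\<bar> \<le> (k2 + L) * \<bar>s - t\<bar>" if "0 \<le> s" "0 \<le> t" for s t
    using z2_diff[of t s] z2_diff[of s t] that by (cases "t \<le> s") auto
  then have "(k2 + L)-lipschitz_on {0..} z2"
    using k2_pos L_nonneg by (auto simp: lipschitz_on_def dist_real_def)
  then show "A \<subseteq> {0..} \<Longrightarrow> continuous_on A z2"
    by (meson lipschitz_on_continuous_on continuous_on_subset)
qed

section \<open>Dini bounds for the pieces of the Lyapunov function\<close>

text \<open>The derivatives \<open>g1\<close>, \<open>g2\<close> are controlled only almost
  everywhere, so \<open>rate\<close> is applied under the integral, with \<open>dp\<close> frozen at
  \<open>z2 t\<close>. Half of \<open>\<epsilon>\<close> pays for the freezing, half for linearising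
  \<open>p\<close>.\<close>

lemma dini_left:
  assumes "t \<ge> 0" and U: "p (z2 t) - z1 t > N"
  shows "dini_le (\<lambda>t. p (z2 t) - z1 t) t (- \<kappa> * \<bar>z2 t\<bar>)"
  unfolding dini_le_def
proof (intro allI impI)
  fix \<epsilon> :: real assume "\<epsilon> > 0"
  let ?P = "k2 + L" and ?d = "dp (z2 t)"
  \<comment> \<open>The cost of replacing \<open>z2 r\<close> by \<open>z2 t\<close> in the rate; it
    is continuous in \<open>r\<close> and vanishes at \<open>r = t\<close>.\<close>
  let ?\<phi> = "\<lambda>r. \<kappa> * \<bar>z2 t\<bar> - \<kappa> * \<bar>z2 r\<bar> + \<bar>?d - dp (z2 r)\<bar> * ?P"
  have P: "?P > 0" using k2_pos L_nonneg by simp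
  have "continuous_on {0..} ?\<phi>" by (intro continuous_intros order.refl)
  from order_tendstoD(2)[OF tendsto_at_right_of_continuous_on_Ici[OF this \<open>t \<ge> 0\<close>], of "\<epsilon> / 2"]
  have "\<forall>\<^sub>F r in at_right t. ?\<phi> r < \<epsilon> / 2" using \<open>\<epsilon> > 0\<close> by simp
  moreover have "continuous_on {0..} (\<lambda>t. p (z2 t) - z1 t)"
    by (intro continuous_intros order.refl)
  from order_tendstoD(1)[OF tendsto_at_right_of_continuous_on_Ici[OF this \<open>t \<ge> 0\<close>] U]
  have "\<forall>\<^sub>F r in at_right t. p (z2 r) - z1 r > N" .
  ultimately have "\<forall>\<^sub>F r in at_right t. ?\<phi> r < \<epsilon> / 2 \<and> p (z2 r) - z1 r > N"
    by (rule eventually_conj)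
  then obtain \<beta> where "\<beta> > t"
    and \<beta>: "\<And>r. t < r \<Longrightarrow> r < \<beta> \<Longrightarrow> ?\<phi> r < \<epsilon> / 2 \<and> p (z2 r) - z1 r > N"
    by (auto simp: eventually_at_right_field)
  have near: "?\<phi> r < \<epsilon> / 2 \<and> p (z2 r) - z1 r > N" if "t \<le> r" "r < \<beta>" for r
    using \<beta>[of r] U \<open>\<epsilon> > 0\<close> that by (cases "r = t") auto
  \<comment> \<open>Dividing by \<open>?P\<close>, a Lipschitz constant of \<open>z2\<close>, makes
    the linearisation error at most \<open>\<epsilon> / 2 * (s - t)\<close>.\<close>
  obtain \<delta> where "\<delta> > 0"
    and \<delta>: "\<And>x. \<bar>x - z2 t\<bar> < \<delta> \<Longrightarrow>
      \<bar>p x - p (z2 t) - ?d * (x - z2 t)\<bar> \<le> \<epsilon> / (2 * ?P) * \<bar>x - z2 t\<bar>"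
  proof -
    have "\<epsilon> / (2 * ?P) > 0" using P \<open>\<epsilon> > 0\<close> by simp
    then show ?thesis
      using p_has_derivative[of "z2 t"] that
      unfolding has_field_derivative_def has_derivative_at_alt real_norm_def by blast
  qed
  have "\<forall>\<^sub>F s in at_right t. s \<in> {t<..<min \<beta> (t + \<delta> / ?P)}"
    using \<open>\<beta> > t\<close> \<open>\<delta> > 0\<close> P by (intro eventually_at_right_real) simp
  then show "\<forall>\<^sub>F s in at_right t.
      p (z2 s) - z1 s - (p (z2 t) - z1 t) \<le> (- \<kappa> * \<bar>z2 t\<bar> + \<epsilon>) * (s - t)"
  proof eventually_elim
    case (elim s)
    have st: "0 \<le> t" "t \<le> s" "s < \<beta>" using elim \<open>t \<ge> 0\<close> by auto
    have "- g1 r + ?d * (g2 r + L) \<le> - \<kappa> * \<bar>z2 t\<bar> + \<epsilon> / 2" if r: "r \<in> {t..s} - S" for r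
    proof -
      have r0: "0 \<le> r" "r \<notin> S" using r st by auto
      have "- (k1 * sqrt (\<eta> r - z1 r) + z2 r) + dp (z2 r) * (g2 r + L) \<le> - \<kappa> * \<bar>z2 r\<bar>"
        using near[of r] noise[OF r0(1)] g2_bound[OF r0] g2_neg[OF r0] r st
        by (intro rate[where N=N]) auto
      moreover have "(?d - dp (z2 r)) * (g2 r + L) \<le> \<bar>?d - dp (z2 r)\<bar> * ?P"
      proof -
        have "(?d - dp (z2 r)) * (g2 r + L) \<le> \<bar>?d - dp (z2 r)\<bar> * \<bar>g2 r + L\<bar>"
          by (metis abs_ge_self abs_mult)
        also have "\<dots> \<le> \<bar>?d - dp (z2 r)\<bar> * ?P"
          using g2_bound[OF r0] L_nonneg by (intro mult_left_mono) auto
        finally show ?thesis .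
      qed
      moreover have "?\<phi> r < \<epsilon> / 2" using near[of r] r st by auto
      ultimately show ?thesis using g1_eq[OF r0] by (simp add: algebra_simps)
    qed
    moreover have "((\<lambda>r. - g1 r + ?d * (g2 r + L)) has_integral
        (- (z1 s - z1 t) + ?d * ((z2 s + D s - (z2 t + D t)) + L * (s - t)))) {t..s}"
      using st has_integral_const_real[of L t s]
      by (intro has_integral_add has_integral_neg has_integral_mult_right g1_integral g2_integral)
         (auto simp: mult.commute)
    ultimately have "- (z1 s - z1 t) + ?d * ((z2 s + D s - (z2 t + D t)) + L * (s - t))
        \<le> (- \<kappa> * \<bar>z2 t\<bar> + \<epsilon> / 2) * (s - t)"
      using has_integral_le_const_negligible st(2) negl by blast
    \<comment> \<open>Since \<open>dp\<close> is nonnegative, the largest possible drop of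
      \<open>D\<close>, namely \<open>L * (s - t)\<close>, is the worst case.\<close>
    moreover have "?d * (z2 s - z2 t) \<le> ?d * ((z2 s + D s - (z2 t + D t)) + L * (s - t))"
      using D_lipschitz[OF st(1,2)] dp_nonneg by (intro mult_left_mono) auto
    moreover have "p (z2 s) - p (z2 t) - ?d * (z2 s - z2 t) \<le> \<epsilon> / 2 * (s - t)"
    proof -
      have z: "\<bar>z2 s - z2 t\<bar> \<le> ?P * (s - t)" by (rule z2_diff[OF st(1,2)])
      also have "\<dots> < \<delta>" using elim P by (simp add: field_simps)
      finally have "p (z2 s) - p (z2 t) - ?d * (z2 s - z2 t) \<le> \<epsilon> / (2 * ?P) * \<bar>z2 s - z2 t\<bar>"
        using \<delta>[of "z2 s"] by (auto simp: abs_le_iff)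
      also have "\<dots> \<le> \<epsilon> / (2 * ?P) * (?P * (s - t))"
        using z P \<open>\<epsilon> > 0\<close> by (intro mult_left_mono) auto
      also have "\<dots> = \<epsilon> / 2 * (s - t)" using P by (simp add: field_simps)
      finally show ?thesis .
    qed
    ultimately show ?case by (simp add: algebra_simps diff_divide_distrib)
  qed
qed

text \<open>To the right of \<open>N\<close> the error \<open>z2\<close> falls at rate at least
  \<open>k2 - L\<close>, so its scaled square falls at rate at least
  \<open>(k2 - L) / c^2 * z2\<close>; this is the fourth margin in \<open>\<kappa>\<close>.\<close>

lemma dini_top:
  assumes "t \<ge> 0" "z1 t > N" "z2 t \<ge> 0"
  shows "dini_le (\<lambda>t. (z2 t)\<^sup>2 / (2 * c\<^sup>2)) t (- \<kappa> * \<bar>z2 t\<bar>)"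
  unfolding dini_le_def
proof (intro allI impI)
  fix \<epsilon> :: real assume "\<epsilon> > 0"
  let ?P = "k2 + L"
  have P: "?P > 0" using k2_pos L_nonneg by simp
  have c: "2 * c\<^sup>2 > 0" using c_pos by simp
  from order_tendstoD(1)[OF tendsto_at_right_of_continuous_on_Ici[OF continuous_on_z1[OF order.refl]
      assms(1)] assms(2)]
  obtain \<beta> where "\<beta> > t" and \<beta>: "\<And>r. t < r \<Longrightarrow> r < \<beta> \<Longrightarrow> z1 r > N"
    by (auto simp: eventually_at_right_field)
  \<comment> \<open>Within this window the quadratic remainder
    \<open>(?P * (s - t))^2 / (2 * c^2)\<close> is at most
    \<open>\<epsilon> * (s - t)\<close>.\<close>
  have "t + 2 * c\<^sup>2 * \<epsilon> / ?P\<^sup>2 > t" using P c \<open>\<epsilon> > 0\<close> by simp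
  with \<open>\<beta> > t\<close> have "\<forall>\<^sub>F s in at_right t. s \<in> {t<..<min \<beta> (t + 2 * c\<^sup>2 * \<epsilon> / ?P\<^sup>2)}"
    by (intro eventually_at_right_real) simp
  then show "\<forall>\<^sub>F s in at_right t.
      (z2 s)\<^sup>2 / (2 * c\<^sup>2) - (z2 t)\<^sup>2 / (2 * c\<^sup>2) \<le> (- \<kappa> * \<bar>z2 t\<bar> + \<epsilon>) * (s - t)"
  proof eventually_elim
    case (elim s)
    have st: "0 \<le> t" "t \<le> s" "s < \<beta>" using elim \<open>t \<ge> 0\<close> by auto
    have "z1 r > N" if "r \<in> {t..s}" for r
      using \<beta>[of r] assms(2) that st by (cases "r = t") auto
    then have dec: "z2 s - z2 t \<le> - (k2 - L) * (s - t)" by (intro z2_decrease st)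
    have "z2 t / c\<^sup>2 * (z2 s - z2 t) \<le> z2 t / c\<^sup>2 * (- (k2 - L) * (s - t))"
      using dec assms(3) by (intro mult_left_mono) auto
    also have "\<dots> = - ((k2 - L) / c\<^sup>2 * (z2 t * (s - t)))"
      by (simp add: divide_inverse algebra_simps)
    also have "\<dots> \<le> - (\<kappa> * (z2 t * (s - t)))"
      using \<kappa>_le(4) assms(3) st by (intro le_imp_neg_le mult_right_mono) auto
    finally have "z2 t / c\<^sup>2 * (z2 s - z2 t) \<le> - (\<kappa> * (z2 t * (s - t)))" .
    moreover have "(z2 s - z2 t)\<^sup>2 / (2 * c\<^sup>2) \<le> \<epsilon> * (s - t)"
    proof -
      have "(z2 s - z2 t)\<^sup>2 \<le> (?P * (s - t))\<^sup>2"
        using power_mono[OF z2_diff[OF st(1,2)], of 2] by simp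
      then have "(z2 s - z2 t)\<^sup>2 / (2 * c\<^sup>2) \<le> (?P * (s - t))\<^sup>2 / (2 * c\<^sup>2)"
        using c by (intro divide_right_mono) auto
      also have "\<dots> = (?P\<^sup>2 * (s - t) / (2 * c\<^sup>2)) * (s - t)"
        by (simp add: power2_eq_square)
      also have "\<dots> \<le> \<epsilon> * (s - t)"
        using elim P c st by (intro mult_right_mono) (auto simp: field_simps)
      finally show ?thesis .
    qed
    moreover have "(z2 s)\<^sup>2 / (2 * c\<^sup>2) - (z2 t)\<^sup>2 / (2 * c\<^sup>2)
        = z2 t / c\<^sup>2 * (z2 s - z2 t) + (z2 s - z2 t)\<^sup>2 / (2 * c\<^sup>2)"
      using c_pos by (simp add: field_simps power2_eq_square)
    ultimately show ?case using assms(3) by (simp add: algebra_simps)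
  qed
qed

end

section \<open>Finite-time convergence\<close>

context st_gains
begin

text \<open>For a level \<open>M \<ge> 0\<close> the upper arc \<open>x2 = c * sqrt (x1 + M)\<close>
  reaches height \<open>c * sqrt (2 * M)\<close> at \<open>x1 = M\<close>; the last term cuts it off
  there by a horizontal line, and symmetrically below.\<close>

definition V :: "real \<Rightarrow> real \<Rightarrow> real" where
  "V x1 x2 = max (max (p x2 - x1) (p (- x2) + x1)) (x2\<^sup>2 / (2 * c\<^sup>2))"

text \<open>Each of \<open>p x2\<close>, \<open>p (- x2)\<close> and the last term of
  \<open>V\<close> is at most \<open>\<delta>^2 / c^2\<close>, so an excess over \<open>M\<close>
  has to come from \<open>x1\<close> or \<open>- x1\<close>.\<close>

lemma V_large:
  assumes "V x1 x2 > M + \<delta>\<^sup>2 / c\<^sup>2" "\<bar>x2\<bar> < \<delta>" "M \<ge> 0"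
  shows "\<bar>x1\<bar> > M"
proof -
  have "x2\<^sup>2 \<le> \<delta>\<^sup>2" using assms(2) by (metis abs_ge_zero less_imp_le power2_abs power_mono)
  then have "x2\<^sup>2 / c\<^sup>2 \<le> \<delta>\<^sup>2 / c\<^sup>2" by (rule divide_right_mono) simp
  moreover have "x2\<^sup>2 / (2 * c\<^sup>2) \<le> x2\<^sup>2 / c\<^sup>2"
    using c_pos by (intro divide_left_mono) auto
  ultimately show ?thesis
    using assms p_le[of x2] p_le[of "- x2"] by (auto simp: V_def max_def split: if_splits)
qed

text \<open>The solution of \<open>1 - x * q = q\<close> for
  \<open>x = \<kappa> * c^2 / (4 * (k2 + L))\<close>: a drop of \<open>x * q * E\<close> takes the
  excess \<open>E\<close> exactly to \<open>q * E\<close>.\<close>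

definition q :: real where
  "q = 1 / (1 + \<kappa> * c\<^sup>2 / (4 * (k2 + L)))"

text \<open>With \<open>\<delta> = c * sqrt (q * E)\<close>, the time
  \<open>\<theta> * sqrt E\<close> consists of \<open>3 * \<delta> / (k2 - L)\<close> for
  \<open>\<bar>z2\<bar>\<close> to reach \<open>\<delta>\<close> and of
  \<open>\<delta> / (2 * (k2 + L))\<close> during which it stays at least
  \<open>\<delta> / 2\<close>.\<close>

definition \<theta> :: real where
  "\<theta> = c * sqrt q * (3 / (k2 - L) + 1 / (2 * (k2 + L)))"

lemma q_pos: "0 < q" and q_less_1: "q < 1"
proof -
  have "\<kappa> * c\<^sup>2 / (4 * (k2 + L)) > 0"
    using \<kappa>_pos c_pos k2_pos L_nonneg by simp
  then show "0 < q" "q < 1" by (simp_all add: q_def)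
qed

lemma \<theta>_nonneg: "\<theta> \<ge> 0"
  using c_pos q_pos L_less L_nonneg by (simp add: \<theta>_def)

end

section \<open>Decrease and contraction of the Lyapunov function along error trajectories\<close>

context st_error
begin

lemma continuous_on_V: "continuous_on {0..} (\<lambda>t. V (z1 t) (z2 t))"
  unfolding V_def using c_pos by (intro continuous_on_max continuous_intros order.refl) auto

lemma dini_V:
  assumes t: "t \<ge> 0" and V: "V (z1 t) (z2 t) > N"
  shows "dini_le (\<lambda>t. V (z1 t) (z2 t)) t (- \<kappa> * \<bar>z2 t\<bar>)"
proof -
  interpret neg: st_error k1 k2 L b c N "\<lambda>t. - z1 t" "\<lambda>t. - z2 t" "\<lambda>t. - D t" "\<lambda>t. - \<eta> t"
     "\<lambda>t. - g1 t" "\<lambda>t. - g2 t" S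
    by (rule st_error_uminus)
  let ?l = "\<lambda>t. p (z2 t) - z1 t" and ?r = "\<lambda>t. p (- z2 t) + z1 t"
    and ?h = "\<lambda>t. (z2 t)\<^sup>2 / (2 * c\<^sup>2)" and ?\<rho> = "- \<kappa> * \<bar>z2 t\<bar>"
  have right: "dini_le ?r t ?\<rho>" if "?r t > N"
    using neg.dini_left[OF t] that by simp
  have cont: "continuous_on {0..} ?l" "continuous_on {0..} ?r" "continuous_on {0..} ?h"
    using c_pos by (intro continuous_intros order.refl; simp)+
  have lr: "continuous_on {0..} (\<lambda>t. max (?l t) (?r t))"
    using cont by (intro continuous_on_max)
  have "dini_le (\<lambda>t. max (max (?l t) (?r t)) (?h t)) t ?\<rho>"
  proof (rule dini_le_max)
    assume "max (?l t) (?r t) \<ge> ?h t"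
    then have "max (?l t) (?r t) > N" using V by (simp add: V_def max_def split: if_splits)
    then show "dini_le (\<lambda>t. max (?l t) (?r t)) t ?\<rho>"
      by (intro dini_le_max dini_left right t tendsto_at_right_of_continuous_on_Ici[OF cont(1) t]
          tendsto_at_right_of_continuous_on_Ici[OF cont(2) t]) auto
  next
    assume h: "?h t \<ge> max (?l t) (?r t)"
    then have hN: "?h t > N" using V by (simp add: V_def max_def split: if_splits)
    have half: "x / (2 * c\<^sup>2) = x / c\<^sup>2 / 2" for x by simp
    show "dini_le ?h t ?\<rho>"
    proof (cases "z2 t \<ge> 0")
      case True
      \<comment> \<open>Here \<open>p (z2 t)\<close> is twice \<open>?h t\<close>, so the last term
        can be the maximum only where \<open>z1 t \<ge> ?h t > N\<close>, as \<open>dini_top\<close>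
        requires.\<close>
      then have "z1 t \<ge> ?h t" using h unfolding half by (simp add: p_def)
      then show ?thesis using hN True by (intro dini_top t) auto
    next
      case False
      then have "- z1 t \<ge> ?h t" using h unfolding half by (simp add: p_def)
      then show ?thesis using hN False neg.dini_top[OF t] by simp
    qed
  qed (use tendsto_at_right_of_continuous_on_Ici[OF lr t]
        tendsto_at_right_of_continuous_on_Ici[OF cont(3) t] in auto)
  then show ?thesis by (simp only: V_def)
qed

lemma V_threshold:
  assumes "0 \<le> t" "t \<le> s"
  shows "V (z1 s) (z2 s) \<le> max (V (z1 t) (z2 t)) N"
proof (rule dini_le_threshold[OF assms(2)])
  show "continuous_on {t..} (\<lambda>t. V (z1 t) (z2 t))"
    by (rule continuous_on_subset[OF continuous_on_V]) (use assms in auto)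
  show "dini_le (\<lambda>t. V (z1 t) (z2 t)) r 0" if "t \<le> r" "N < V (z1 r) (z2 r)" for r
    by (rule dini_le_mono[OF dini_V]) (use that assms \<kappa>_pos in auto)
qed

text \<open>To leave the side \<open>z1 > N\<close>, the error \<open>z1\<close> would have to pass
  through \<open>0\<close>, which the strip excludes. So \<open>z2\<close> falls by at least
  \<open>3 * \<delta>\<close>, more than the width \<open>2 * \<delta>\<close> of the strip.\<close>

lemma leaves_strip:
  assumes "t \<ge> 0" "\<delta> > 0" and z1: "z1 t > N"
    and strip: "\<And>r. t \<le> r \<Longrightarrow> r \<le> t + 3 * \<delta> / (k2 - L) \<Longrightarrow> \<bar>z2 r\<bar> < \<delta> \<and> \<bar>z1 r\<bar> > N"
  shows False
proof -
  let ?s = "t + 3 * \<delta> / (k2 - L)"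
  have ts: "t \<le> ?s" using \<open>\<delta> > 0\<close> L_less by simp
  have "z1 r > N" if r: "r \<in> {t..?s}" for r
  proof (rule ccontr)
    assume "\<not> z1 r > N"
    then have "z1 r \<le> 0" "0 \<le> z1 t" "t \<le> r" using strip[of r] r z1 N_nonneg by auto
    moreover have "continuous_on {t..r} z1" using \<open>t \<ge> 0\<close> by (intro continuous_on_z1) auto
    ultimately obtain x where "t \<le> x" "x \<le> r" "z1 x = 0"
      using IVT2'[of z1 r 0 t] by blast
    then show False using strip[of x] r N_nonneg by auto
  qed
  then have "z2 ?s - z2 t \<le> - (k2 - L) * (?s - t)"
    by (intro z2_decrease ts \<open>t \<ge> 0\<close>)
  moreover have "(k2 - L) * (?s - t) = 3 * \<delta>" using L_less by simp
  ultimately have "z2 ?s - z2 t \<le> - (3 * \<delta>)" by (simp only: mult_minus_left)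
  with strip[of t] strip[of ?s] ts show False by auto
qed

text \<open>If the final value exceeded \<open>N + q * E\<close>, then so would all earlier ones in
  the interval. A small \<open>\<bar>z2\<bar>\<close> would then force
  \<open>\<bar>z1\<bar> > N\<close>, so \<open>\<bar>z2\<bar>\<close> soon reaches
  \<open>\<delta>\<close>, and the decay that follows contradicts the assumed excess.\<close>

lemma V_contracts:
  assumes t: "t \<ge> 0" and "E > 0" and E: "V (z1 t) (z2 t) \<le> N + E"
  shows "V (z1 (t + \<theta> * sqrt E)) (z2 (t + \<theta> * sqrt E)) \<le> N + q * E"
proof (rule ccontr)
  interpret neg: st_error k1 k2 L b c N "\<lambda>t. - z1 t" "\<lambda>t. - z2 t" "\<lambda>t. - D t" "\<lambda>t. - \<eta> t"
     "\<lambda>t. - g1 t" "\<lambda>t. - g2 t" S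
    by (rule st_error_uminus)
  let ?P = "k2 + L" and ?V = "\<lambda>t. V (z1 t) (z2 t)"
  let ?T = "t + \<theta> * sqrt E"
  \<comment> \<open>Chosen so that \<open>\<delta>^2 / c^2\<close> is the excess
    \<open>q * E\<close> needed in \<open>V_large\<close>.\<close>
  define \<delta> where "\<delta> = c * sqrt (q * E)"
  let ?t1 = "t + 3 * \<delta> / (k2 - L)"
  have P: "?P > 0" using k2_pos L_nonneg by simp
  have "\<delta> > 0" using c_pos q_pos \<open>E > 0\<close> by (simp add: \<delta>_def)
  have \<delta>2: "\<delta>\<^sup>2 = c\<^sup>2 * (q * E)"
    using q_pos \<open>E > 0\<close> by (simp add: \<delta>_def power_mult_distrib)
  have T: "?T = ?t1 + \<delta> / (2 * ?P)"
    by (simp add: \<theta>_def \<delta>_def real_sqrt_mult algebra_simps add_divide_distrib)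
  assume "\<not> ?V ?T \<le> N + q * E"
  then have VT: "?V ?T > N + q * E" by simp
  have Vr: "?V r > N + q * E" if r: "t \<le> r" "r \<le> ?T" for r
  proof -
    have "?V ?T \<le> max (?V r) N" using V_threshold[of r ?T] r t by simp
    moreover have "q * E > 0" using q_pos \<open>E > 0\<close> by simp
    ultimately show ?thesis using VT by (simp add: max_def split: if_splits)
  qed
  have "t \<le> ?t1" "?t1 \<le> ?T" using T \<open>\<delta> > 0\<close> L_less P by auto
  have "\<exists>s. t \<le> s \<and> s \<le> ?t1 \<and> \<bar>z2 s\<bar> \<ge> \<delta>"
  proof (rule ccontr)
    assume "\<not> ?thesis"
    then have z2: "\<bar>z2 r\<bar> < \<delta>" if "t \<le> r" "r \<le> ?t1" for r using that by force
    have strip: "\<bar>z2 r\<bar> < \<delta> \<and> \<bar>z1 r\<bar> > N" if "t \<le> r" "r \<le> ?t1" for r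
      using V_large[of N \<delta> "z1 r" "z2 r"] Vr[of r] z2[OF that] that N_nonneg \<open>?t1 \<le> ?T\<close> c_pos
      by (simp add: \<delta>2)
    consider "z1 t > N" | "- z1 t > N" using strip[of t] \<open>t \<le> ?t1\<close> by fastforce
    then show False
    proof cases
      case 1
      show False by (rule leaves_strip[OF t \<open>\<delta> > 0\<close> 1 strip])
    next
      case 2
      show False by (rule neg.leaves_strip[OF t \<open>\<delta> > 0\<close> 2]) (use strip in auto)
    qed
  qed
  then obtain s where s: "t \<le> s" "s \<le> ?t1" "\<bar>z2 s\<bar> \<ge> \<delta>" by blast
  \<comment> \<open>In this time \<open>z2\<close> changes by at most \<open>\<delta> / 2\<close>,
    hence keeps at least half of its size.\<close>
  let ?s' = "s + \<delta> / (2 * ?P)"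
  have "?V ?s' - ?V s \<le> - (\<kappa> * \<delta> / 2) * (?s' - s)"
  proof (rule dini_le_decrease)
    show "s \<le> ?s'" using \<open>\<delta> > 0\<close> P by simp
    show "continuous_on {s..?s'} ?V"
      by (rule continuous_on_subset[OF continuous_on_V]) (use s t in auto)
    show "dini_le ?V r (- (\<kappa> * \<delta> / 2))" if r: "s \<le> r" "r < ?s'" for r
    proof (rule dini_le_mono[OF dini_V])
      show "0 \<le> r" using r s t by simp
      have "r \<le> ?T" using r s T by simp
      moreover have "q * E > 0" using q_pos \<open>E > 0\<close> by simp
      ultimately show "N < ?V r" using Vr[of r] r s by simp
      have "\<bar>z2 r - z2 s\<bar> \<le> ?P * (r - s)" using r s t by (intro z2_diff) auto
      also have "\<dots> \<le> \<delta> / 2" using r P by (simp add: field_simps)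
      finally have "\<bar>z2 r\<bar> \<ge> \<delta> / 2" using s(3) by linarith
      then have "\<kappa> * (\<delta> / 2) \<le> \<kappa> * \<bar>z2 r\<bar>" using \<kappa>_pos by (intro mult_left_mono) auto
      then show "- \<kappa> * \<bar>z2 r\<bar> \<le> - (\<kappa> * \<delta> / 2)" by simp
    qed
  qed
  also have "- (\<kappa> * \<delta> / 2) * (?s' - s) = - (\<kappa> * c\<^sup>2 / (4 * ?P) * (q * E))"
  proof -
    have "- (\<kappa> * \<delta> / 2) * (?s' - s) = - (\<kappa> * \<delta>\<^sup>2 / (4 * ?P))"
      by (simp add: power2_eq_square)
    then show ?thesis by (simp add: \<delta>2)
  qed
  finally have "?V ?s' \<le> ?V s - \<kappa> * c\<^sup>2 / (4 * ?P) * q * E" by simp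
  also have "?V s \<le> N + E"
    using V_threshold[of t s] E s t \<open>E > 0\<close> by auto
  also have "N + E - \<kappa> * c\<^sup>2 / (4 * ?P) * q * E = N + q * E"
  proof -
    define x where "x = \<kappa> * c\<^sup>2 / (4 * ?P)"
    have "x \<ge> 0" using \<kappa>_pos P by (simp add: x_def)
    moreover have "q = 1 / (1 + x)" by (simp only: q_def x_def)
    ultimately have "q * (1 + x) = 1" by simp
    then have "E - x * q * E = q * E" by algebra
    then show ?thesis by (simp add: x_def)
  qed
  finally have "?V ?s' \<le> N + q * E" by simp
  moreover have "?V ?s' > N + q * E" using s T \<open>\<delta> > 0\<close> P by (intro Vr) (auto intro: order.trans)
  ultimately show False by simp
qed

text \<open>Stage \<open>n\<close> starts with excess at most \<open>q ^ n * E\<close> and lasts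
  \<open>\<theta> * sqrt (q ^ n * E)\<close>. All stages end by time \<open>t\<close>, so
  \<open>V\<close> is at most \<open>N\<close> there, and its last term bounds
  \<open>z2\<close>.\<close>

lemma finite_time_bound:
  assumes "E > 0" and E: "V (z1 0) (z2 0) \<le> N + E"
    and t: "t \<ge> \<theta> * sqrt E / (1 - sqrt q)"
  shows "\<bar>z2 t\<bar> \<le> c * sqrt (2 * N)"
proof -
  let ?V = "\<lambda>t. V (z1 t) (z2 t)"
  define T where "T n = \<theta> * sqrt E * (\<Sum>k<n. sqrt q ^ k)" for n
  have q: "0 < sqrt q" "sqrt q < 1" using q_pos q_less_1 by auto
  have T_nonneg: "T n \<ge> 0" for n
    unfolding T_def using q \<theta>_nonneg \<open>E > 0\<close> by (intro mult_nonneg_nonneg sum_nonneg) auto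
  have T_le: "T n \<le> t" for n
  proof -
    have "(\<Sum>k<n. sqrt q ^ k) \<le> 1 / (1 - sqrt q)"
      using q by (subst sum_gp_strict) (auto intro: divide_right_mono)
    then have "T n \<le> \<theta> * sqrt E * (1 / (1 - sqrt q))"
      unfolding T_def using \<theta>_nonneg \<open>E > 0\<close> by (intro mult_left_mono) auto
    with t show ?thesis by simp
  qed
  have VT: "?V (T n) \<le> N + q ^ n * E" for n
  proof (induction n)
    case 0
    then show ?case using E by (simp add: T_def)
  next
    case (Suc n)
    have "T (Suc n) = T n + \<theta> * sqrt (q ^ n * E)"
      by (simp add: T_def real_sqrt_mult real_sqrt_power algebra_simps)
    then show ?case
      using V_contracts[OF T_nonneg, of "q ^ n * E" n] Suc q_pos \<open>E > 0\<close>
      by (simp add: mult.assoc)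
  qed
  have "?V t \<le> N + q ^ n * E" for n
  proof -
    have "q ^ n * E \<ge> 0" using q_pos \<open>E > 0\<close> by simp
    then show ?thesis using V_threshold[OF T_nonneg T_le, of n] VT[of n] by linarith
  qed
  moreover have "(\<lambda>n. N + q ^ n * E) \<longlonglongrightarrow> N + 0 * E"
    using q_pos q_less_1 by (intro tendsto_intros LIMSEQ_power_zero) auto
  ultimately have "?V t \<le> N" using LIMSEQ_le_const by fastforce
  then have "(z2 t)\<^sup>2 / (2 * c\<^sup>2) \<le> N" by (simp add: V_def)
  then have "(z2 t)\<^sup>2 \<le> 2 * N * c\<^sup>2" using c_pos by (simp add: field_simps)
  then have "\<bar>z2 t\<bar> \<le> sqrt (2 * N * c\<^sup>2)" using real_le_rsqrt[of "\<bar>z2 t\<bar>"] by simp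
  then show ?thesis using c_pos by (simp add: real_sqrt_mult mult_ac)
qed

end

section \<open>The differentiator\<close>

lemma AE_lborel_negligibleE:
  assumes "AE t in lborel. P t"
  obtains S where "negligible S" "\<And>t. t \<notin> S \<Longrightarrow> P t"
proof -
  from assms obtain S where "S \<in> null_sets lborel" "{t \<in> space lborel. \<not> P t} \<subseteq> S"
    by (auto simp: eventually_ae_filter)
  then show thesis
    by (intro that[of S]) (auto simp: negligible_iff_null_sets null_sets_completionI)
qed

text \<open>The Lipschitz constant in \<open>in_FL\<close> is arbitrary; the almost everywhere
  bound, applied to \<open>f'\<close> and to its negative, sharpens it to \<open>L\<close>.\<close>

lemma in_FL_deriv_diff:
  assumes "in_FL L f f'" "0 \<le> t" "t \<le> s"
  shows "\<bar>f' s - f' t\<bar> \<le> L * (s - t)"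
proof -
  from assms(1) obtain K where K: "K-lipschitz_on {0..} f'"
    and ae: "AE r in lborel. r > 0 \<longrightarrow> f' differentiable (at r) \<and> \<bar>deriv f' r\<bar> \<le> L"
    by (auto simp: in_FL_def)
  have lip: "K-lipschitz_on {t..s} f'" by (rule lipschitz_on_subset[OF K]) (use assms in auto)
  have d: "(f' has_real_derivative deriv f' r) (at r)" if "f' differentiable (at r)" for r
    using that DERIV_imp_deriv by (auto simp: real_differentiable_def)
  have "f' s - f' t \<le> L * (s - t)"
  proof (rule diff_le_of_AE_deriv_le[OF assms(3) lip])
    show "AE r in lborel. t < r \<longrightarrow> r < s \<longrightarrow> (\<exists>d\<le>L. (f' has_real_derivative d) (at r))"
      using ae by eventually_elim (use d assms(2) in \<open>force simp: abs_le_iff\<close>)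
  qed
  moreover have "- f' s - - f' t \<le> L * (s - t)"
  proof (rule diff_le_of_AE_deriv_le[OF assms(3)])
    show "K-lipschitz_on {t..s} (\<lambda>t. - f' t)" using lip by (simp add: lipschitz_on_def dist_minus)
    show "AE r in lborel. t < r \<longrightarrow> r < s \<longrightarrow> (\<exists>d\<le>L. ((\<lambda>t. - f' t) has_real_derivative d) (at r))"
      using ae by eventually_elim
        (use DERIV_minus[OF d] assms(2) in \<open>force simp: abs_le_iff\<close>)
  qed
  ultimately show ?thesis by (simp add: abs_le_iff)
qed

text \<open>Since \<open>z2 + f'\<close> is the second state itself, \<open>g2\<close> is its plain
  derivative and the second derivative of \<open>f\<close> never enters an integral.\<close>

lemma st_error_of_filippov_solution:
  assumes gains: "st_gains (l1 * sqrt L) (l2 * L) L b c"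
    and f: "in_FL L f f'" and \<eta>: "in_EN N \<eta>"
    and y: "filippov_solution (std_field l1 l2 L (\<lambda>t. f t + \<eta> t)) y"
    and l2: "l2 \<ge> 0"
  shows "\<exists>g1 g2 S. st_error (l1 * sqrt L) (l2 * L) L b c N
    (\<lambda>t. fst (y t) - f t) (\<lambda>t. snd (y t) - f' t) f' \<eta> g1 g2 S"
proof -
  interpret st_gains "l1 * sqrt L" "l2 * L" L b c by (rule gains)
  from y obtain g where g: "\<And>t. t \<ge> 0 \<Longrightarrow> (g has_integral (y t - y 0)) {0..t}"
    and ae: "AE t in lborel. t \<ge> 0 \<longrightarrow>
      g t \<in> filippov_set (std_field l1 l2 L (\<lambda>t. f t + \<eta> t)) t (y t)"
    unfolding filippov_solution_def by blast
  obtain S where "negligible S"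
    and S: "\<And>t. t \<notin> S \<Longrightarrow> t \<ge> 0 \<longrightarrow>
      g t \<in> filippov_set (std_field l1 l2 L (\<lambda>t. f t + \<eta> t)) t (y t)"
    using AE_lborel_negligibleE[OF ae] by blast
  have g_ts: "(g has_integral (y s - y t)) {t..s}" if ts: "0 \<le> t" "t \<le> s" for t s
  proof -
    have "g integrable_on {0..s}" using g[of s] ts by auto
    then have "g integrable_on {t..s}" by (rule integrable_on_subinterval) (use ts in auto)
    then have h: "(g has_integral integral {t..s} g) {t..s}" by (rule integrable_integral)
    have "(g has_integral (y t - y 0 + integral {t..s} g)) {0..s}"
      by (rule has_integral_combine[OF ts g[OF ts(1)] h])
    then have "y t - y 0 + integral {t..s} g = y s - y 0"
      using g[of s] ts by (intro has_integral_unique) auto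
    then have "integral {t..s} g = y s - y t" by (simp add: algebra_simps)
    then show ?thesis using h by simp
  qed
  have f'_ts: "(f' has_integral (f s - f t)) {t..s}" if ts: "0 \<le> t" "t \<le> s" for t s
  proof (rule fundamental_theorem_of_calculus[OF ts(2)])
    fix x assume "x \<in> {t..s}"
    then have "(f has_real_derivative f' x) (at x within {0..})" using f ts by (simp add: in_FL_def)
    then have "(f has_real_derivative f' x) (at x within {t..s})"
      by (rule DERIV_subset) (use ts in auto)
    then show "(f has_vector_derivative f' x) (at x within {t..s})"
      by (simp add: has_real_derivative_iff_has_vector_derivative)
  qed
  have "st_error (l1 * sqrt L) (l2 * L) L b c N (\<lambda>t. fst (y t) - f t) (\<lambda>t. snd (y t) - f' t) f' \<eta>
      (\<lambda>t. fst (g t) - f' t) (\<lambda>t. snd (g t)) S"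
  proof
    fix s t :: real assume ts: "0 \<le> t" "t \<le> s"
    have "((fst \<circ> g) has_integral fst (y s - y t)) {t..s}"
      by (rule has_integral_linear[OF g_ts[OF ts] bounded_linear_fst])
    from has_integral_diff[OF this f'_ts[OF ts]]
    show "((\<lambda>t. fst (g t) - f' t) has_integral fst (y s) - f s - (fst (y t) - f t)) {t..s}"
      by (simp add: o_def algebra_simps)
    have "((snd \<circ> g) has_integral snd (y s - y t)) {t..s}"
      by (rule has_integral_linear[OF g_ts[OF ts] bounded_linear_snd])
    then show "((\<lambda>t. snd (g t)) has_integral
        snd (y s) - f' s + f' s - (snd (y t) - f' t + f' t)) {t..s}"
      by (simp add: o_def)
    show "\<bar>f' s - f' t\<bar> \<le> L * (s - t)" by (rule in_FL_deriv_diff[OF f ts])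
  next
    show "negligible S" by fact
    show "\<And>t. 0 \<le> t \<Longrightarrow> \<bar>\<eta> t\<bar> \<le> N" using \<eta> by (simp add: in_EN_def)
  next
    fix t :: real assume t: "0 \<le> t" "t \<notin> S"
    then have "g t \<in> filippov_set (std_field l1 l2 L (\<lambda>t. f t + \<eta> t)) t (y t)" using S by simp
    note field = std_field_filippov[OF this l2 L_nonneg]
    show "fst (g t) - f' t = l1 * sqrt L * sqrt (\<eta> t - (fst (y t) - f t)) + (snd (y t) - f' t)"
      using field(1) by (simp add: algebra_simps)
    show "\<bar>snd (g t)\<bar> \<le> l2 * L" by (rule field(2))
    show "fst (y t) - f t < \<eta> t \<Longrightarrow> snd (g t) = l2 * L" using field(3) by simp
    show "\<eta> t < fst (y t) - f t \<Longrightarrow> snd (g t) = - (l2 * L)" using field(4) by simp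
  qed
  then show ?thesis by blast
qed

text \<open>The choice \<open>b = k1 / 2\<close> maximises \<open>b * (k1 - b)\<close> and turns the
  lower bound on \<open>l1\<close> into \<open>b_gain\<close>. The upper bound becomes
  \<open>c_return\<close>, and \<open>\<alpha> > 1\<close> gives \<open>c_large\<close>.\<close>

lemma st_gains_of_parameters:
  fixes L \<alpha> l1 l2 :: real
  assumes "L > 0" and \<alpha>: "1 < \<alpha>" "\<alpha> \<le> 4" and l: "l1 > 0" "l2 > 0"
    and lower: "1 < l1 / sqrt (8 * (l2 + 1))"
    and upper: "l1 / sqrt (8 * (l2 + 1))
           < ((\<alpha> + 1) * l2 + \<alpha> - 1) / (2 * sqrt \<alpha> * (l2 + 1))"
  shows "st_gains (l1 * sqrt L) (l2 * L) L (l1 * sqrt L / 2) (sqrt (2 * \<alpha> * (l2 + 1) * L))"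
proof
  let ?c = "sqrt (2 * \<alpha> * (l2 + 1) * L)"
  define a where "a = sqrt \<alpha>"
  have a: "1 < a" "a \<le> 2" "a\<^sup>2 = \<alpha>"
    using \<alpha> real_sqrt_le_mono[of \<alpha> 4] by (auto simp: a_def)
  have c2: "?c\<^sup>2 = 2 * \<alpha> * (l2 + 1) * L" using assms by simp
  have "1 < ((\<alpha> + 1) * l2 + \<alpha> - 1) / (2 * a * (l2 + 1))"
    using lower upper by (simp add: a_def)
  then have "2 * a * (l2 + 1) < (\<alpha> + 1) * l2 + \<alpha> - 1"
    using a l by (subst (asm) less_divide_eq_1_pos) auto
  \<comment> \<open>The right-hand side of the previous inequality is
    \<open>(a^2 + 1) * (l2 + 1) - 2\<close>. As \<open>\<alpha> \<le> 4\<close> means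
    \<open>a - 1 \<le> 1\<close>, this forces \<open>l2 > 1\<close>.\<close>
  then have "2 < (a - 1)\<^sup>2 * (l2 + 1)"
    by (simp add: a(3)[symmetric] power2_eq_square algebra_simps)
  also have "\<dots> \<le> 1 * (l2 + 1)"
    using a l by (intro mult_right_mono power_le_one) auto
  finally have "l2 > 1" by simp
  then show "L < l2 * L" using \<open>L > 0\<close> by simp
  show "0 \<le> L" "0 < l1 * sqrt L / 2" "0 < ?c" using assms by auto
  have lL: "(l2 + 1) * L > 0" using assms by simp
  then show "2 * (l2 * L + L) < ?c\<^sup>2"
    unfolding c2 using \<alpha> mult_strict_right_mono[OF \<alpha>(1) lL] by (simp add: algebra_simps)
  have "sqrt (8 * (l2 + 1)) < l1" using lower l by (subst (asm) less_divide_eq_1_pos) auto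
  then have "(sqrt (8 * (l2 + 1)))\<^sup>2 < l1\<^sup>2" using l by (intro power_strict_mono) auto
  then have "8 * (l2 + 1) * L < l1\<^sup>2 * L" using l \<open>L > 0\<close> by simp
  then show "2 * (l2 * L + L) < l1 * sqrt L / 2 * (l1 * sqrt L - l1 * sqrt L / 2)"
    using \<open>L > 0\<close> by (simp add: power2_eq_square algebra_simps)
  show "?c * (l1 * sqrt L - ?c) < 2 * (l2 * L - L)"
  proof -
    have s: "sqrt (8 * (l2 + 1)) = 2 * sqrt (2 * (l2 + 1))"
      using real_sqrt_mult[of 4 "2 * (l2 + 1)"] by simp
    have "sqrt (2 * (l2 + 1)) * sqrt (2 * (l2 + 1)) = 2 * (l2 + 1)" using l by simp
    \<comment> \<open>The factor \<open>a * sqrt (2 * (l2 + 1))\<close> is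
      \<open>?c / sqrt L\<close>; multiplying the bound on \<open>l1\<close> by it removes the root
      of \<open>l2 + 1\<close> from the right-hand side.\<close>
    then have ss: "sqrt (8 * (l2 + 1)) * (a * sqrt (2 * (l2 + 1))) = 2 * (a * (2 * (l2 + 1)))"
      unfolding s by algebra
    have "l1 < ((\<alpha> + 1) * l2 + \<alpha> - 1) / (2 * a * (l2 + 1)) * sqrt (8 * (l2 + 1))"
      using upper l by (subst (asm) pos_divide_less_eq) (auto simp: a_def)
    then have "l1 * (a * sqrt (2 * (l2 + 1))) <
        ((\<alpha> + 1) * l2 + \<alpha> - 1) / (2 * a * (l2 + 1)) * sqrt (8 * (l2 + 1)) * (a * sqrt (2 * (l2 + 1)))"
      using a l by (intro mult_strict_right_mono) auto
    also have "\<dots> = ((\<alpha> + 1) * l2 + \<alpha> - 1) / (2 * a * (l2 + 1)) * (2 * a * (2 * (l2 + 1)))"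
      by (simp only: mult.assoc ss)
    also have "\<dots> = 2 * ((\<alpha> + 1) * l2 + \<alpha> - 1)"
      using a(1) l by (simp add: divide_simps) (simp add: algebra_simps)
    finally have "l1 * (a * sqrt (2 * (l2 + 1))) * L < 2 * ((\<alpha> + 1) * l2 + \<alpha> - 1) * L"
      using \<open>L > 0\<close> by simp
    moreover have "?c = a * sqrt (2 * (l2 + 1)) * sqrt L"
      unfolding a_def real_sqrt_mult[symmetric] by (simp add: algebra_simps)
    then have "?c * (l1 * sqrt L) = l1 * (a * sqrt (2 * (l2 + 1))) * (sqrt L * sqrt L)"
      by (simp only: ac_simps)
    then have "?c * (l1 * sqrt L) = l1 * (a * sqrt (2 * (l2 + 1))) * L"
      using \<open>L > 0\<close> by simp
    ultimately have "?c * (l1 * sqrt L) < 2 * ((\<alpha> + 1) * l2 + \<alpha> - 1) * L"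
      by (simp only:)
    moreover have "?c * (l1 * sqrt L - ?c) = ?c * (l1 * sqrt L) - ?c\<^sup>2"
      by (simp only: right_diff_distrib power2_eq_square)
    ultimately have "?c * (l1 * sqrt L - ?c)
        < 2 * ((\<alpha> + 1) * l2 + \<alpha> - 1) * L - 2 * \<alpha> * (l2 + 1) * L"
      unfolding c2 by linarith
    also have "\<dots> = 2 * (l2 * L - L)" by (simp add: algebra_simps)
    finally show ?thesis .
  qed
qed

theorem theorem1:
  fixes L N \<alpha> l1 l2 :: real
  assumes "L > 0" and "N \<ge> 0" and "1 < \<alpha>" and "\<alpha> \<le> 4"
    and "l1 > 0" and "l2 > 0"
    and "1 < l1 / sqrt (8 * (l2 + 1))"
    and "l1 / sqrt (8 * (l2 + 1))
           < ((\<alpha> + 1) * l2 + \<alpha> - 1) / (2 * sqrt \<alpha> * (l2 + 1))"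
  shows "\<exists>\<tau> :: real \<Rightarrow> real \<Rightarrow> real.
           \<forall>f f' \<eta> :: real \<Rightarrow> real. \<forall>y :: real \<Rightarrow> real \<times> real.
             in_FL L f f' \<longrightarrow> in_EN N \<eta> \<longrightarrow>
             filippov_solution (std_field l1 l2 L (\<lambda>t. f t + \<eta> t)) y \<longrightarrow>
             y 0 = (f 0 + \<eta> 0, 0) \<longrightarrow>
             (\<forall>t \<ge> \<tau> (f' 0) (\<eta> 0).
                \<bar>snd (y t) - f' t\<bar> \<le> 2 * sqrt (\<alpha> * (l2 + 1)) * sqrt (N * L))"
proof -
  define b c where "b = l1 * sqrt L / 2" and "c = sqrt (2 * \<alpha> * (l2 + 1) * L)"
  have gains: "st_gains (l1 * sqrt L) (l2 * L) L b c"
    unfolding b_def c_def by (rule st_gains_of_parameters) fact+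
  interpret st_gains "l1 * sqrt L" "l2 * L" L b c by (rule gains)
  \<comment> \<open>The initial errors are \<open>z1 0 = \<eta> 0\<close> and
    \<open>z2 0 = - f' 0\<close>, so the settling time depends on these two values only; the
    \<open>+ 1\<close> makes the excess positive.\<close>
  define E where "E d e = \<bar>V e (- d)\<bar> + 1" for d e
  have bound: "\<bar>snd (y t) - f' t\<bar> \<le> 2 * sqrt (\<alpha> * (l2 + 1)) * sqrt (N * L)"
    if f: "in_FL L f f'" and \<eta>: "in_EN N \<eta>"
      and y: "filippov_solution (std_field l1 l2 L (\<lambda>t. f t + \<eta> t)) y"
      and y0: "y 0 = (f 0 + \<eta> 0, 0)"
      and t: "t \<ge> \<theta> * sqrt (E (f' 0) (\<eta> 0)) / (1 - sqrt q)" for f f' \<eta> y t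
  proof -
    obtain g1 g2 S where "st_error (l1 * sqrt L) (l2 * L) L b c N
        (\<lambda>t. fst (y t) - f t) (\<lambda>t. snd (y t) - f' t) f' \<eta> g1 g2 S"
      using st_error_of_filippov_solution[OF gains f \<eta> y] \<open>l2 > 0\<close> by auto
    then interpret st_error "l1 * sqrt L" "l2 * L" L b c N "\<lambda>t. fst (y t) - f t"
      "\<lambda>t. snd (y t) - f' t" f' \<eta> g1 g2 S .
    have "V (fst (y 0) - f 0) (snd (y 0) - f' 0) \<le> N + E (f' 0) (\<eta> 0)"
      using y0 \<open>N \<ge> 0\<close> by (simp add: E_def)
    then have "\<bar>snd (y t) - f' t\<bar> \<le> c * sqrt (2 * N)"
      using t by (intro finite_time_bound[of "E (f' 0) (\<eta> 0)"]) (auto simp: E_def)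
    also have "c * sqrt (2 * N) = sqrt (4 * (\<alpha> * (l2 + 1)) * (N * L))"
      by (simp add: c_def real_sqrt_mult[symmetric] mult_ac)
    also have "\<dots> = 2 * sqrt (\<alpha> * (l2 + 1)) * sqrt (N * L)"
      by (simp add: real_sqrt_mult)
    finally show ?thesis .
  qed
  show ?thesis
    by (rule exI[of _ "\<lambda>d e. \<theta> * sqrt (E d e) / (1 - sqrt q)"]) (use bound in blast)
qed

end
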